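(* Let $G$ be a digraph. The following properties are equivalent: 1. $G$ is an oriented simple co-graph. 2. $G\in\mathrm{Free}(\{D_1,D_5,D_8,Q_7,\text{co-}D_{11},\overleftrightarrow{K_2}\})$. 3. $G\in\mathrm{Free}(\{D_8,Q_7,\text{co-}D_{11},\overleftrightarrow{K_2}\})$ and $G$ is transitive.
   Context: Digraphs $G=(V,E)$ are finite with nonempty vertex set and $E\subseteq\{(u,v): u,v\in V,\ u\neq v\}$ (no loops, no multiple arcs; both $(u,v)$ and $(v,u)$ may be present). All classes are closed under isomorphism. For a set $F$ of digraphs, $\mathrm{Free}(F)$ is the class of all digraphs having no induced subdigraph isomorphic to a member of $F$. A digraph $G=(V,E)$ is transitive if for all arcs $(u,v),(v,w)\in E$ with $u\neq w$ also $(u,w)\in E$. Operations on vertex-disjoint digraphs $G_1=(V_1,E_1)$, $G_2=(V_2,E_2)$: each result has vertex set $V_1\cup V_2$; $G_1\oplus G_2$ has arc set $E_1\cup E_2$; $G_1\oslash G_2$ has arc set $E_1\cup E_2\cup\{(u,v):u\in V_1,v\in V_2\}$. The symbol $\bullet$ is a one-vertex digraph. Oriented simple co-graphs: the smallest class containing every one-vertex digraph and containing $G\oplus I$, $G\oslash I$, $I\oslash G$ whenever it contains $G$ and $I$ is an edgeless digraph. Special digraphs: $\overleftrightarrow{K_2}$ has two vertices and both arcs between them; $\overrightarrow{P_2}$ has two vertices and exactly one arc. $D_1$: vertices $a,b,c$, arcs $(a,b),(b,c)$. $D_5$: the directed cycle $(a,b),(b,c),(c,a)$. $D_8$: vertices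 $a,b,c,d$, arcs $(a,b),(c,b),(c,d)$. $\text{co-}D_{11}=\overrightarrow{P_2}\oplus\overrightarrow{P_2}$. $Q_7=Y_4\oslash Y_4$ (two disjoint copies), where $Y_4=\overrightarrow{P_2}\oplus\bullet$. *)

theory Defs
  imports "Graph_Theory.Graph_Theory"
begin

text \<open>
  Digraphs without parallel arcs are \<^typ>\<open>'a pair_pre_digraph\<close> records;
  \<^const>\<open>pair_digraph\<close> makes them finite, loop-free and well-formed but does not
  exclude the empty vertex set.
\<close>

definition is_digraph :: "'a pair_pre_digraph \<Rightarrow> bool" where
  "is_digraph G \<longleftrightarrow> pair_digraph G \<and> pverts G \<noteq> {}"

definition edgeless :: "'a pair_pre_digraph \<Rightarrow> bool" where
  "edgeless G \<longleftrightarrow> is_digraph G \<and> parcs G = {}"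

definition transitive_digraph :: "'a pair_pre_digraph \<Rightarrow> bool" where
  "transitive_digraph G \<longleftrightarrow>
    (\<forall>u v w. (u, v) \<in> parcs G \<and> (v, w) \<in> parcs G \<and> u \<noteq> w \<longrightarrow> (u, w) \<in> parcs G)"

text \<open>
  The operations are only meaningful for vertex-disjoint arguments; disjointness is required
  wherever they are used.
\<close>

definition disj_union ::
  "'a pair_pre_digraph \<Rightarrow> 'a pair_pre_digraph \<Rightarrow> 'a pair_pre_digraph" (infixl \<open>\<oplus>\<close> 65) where
  "G \<oplus> H = \<lparr> pverts = pverts G \<union> pverts H, parcs = parcs G \<union> parcs H \<rparr>"

definition order_comp ::
  "'a pair_pre_digraph \<Rightarrow> 'a pair_pre_digraph \<Rightarrow> 'a pair_pre_digraph" (infixl \<open>\<oslash>\<close> 65) where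
  "G \<oslash> H = \<lparr> pverts = pverts G \<union> pverts H,
             parcs = parcs G \<union> parcs H \<union> pverts G \<times> pverts H \<rparr>"

definition single_vertex :: "'a \<Rightarrow> 'a pair_pre_digraph" where
  "single_vertex v = \<lparr> pverts = {v}, parcs = {} \<rparr>"

text \<open>
  Since the vertex names are arbitrary in every rule, the class is closed under isomorphism
  without a separate rule for it; see the lemma below.
\<close>

inductive oriented_simple_cograph :: "'a pair_pre_digraph \<Rightarrow> bool" where
  single: "oriented_simple_cograph (single_vertex v)"
| union: "\<lbrakk> oriented_simple_cograph G; edgeless I; pverts G \<inter> pverts I = {} \<rbrakk>
    \<Longrightarrow> oriented_simple_cograph (G \<oplus> I)"
| order_right: "\<lbrakk> oriented_simple_cograph G; edgeless I; pverts G \<inter> pverts I = {} \<rbrakk>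
    \<Longrightarrow> oriented_simple_cograph (G \<oslash> I)"
| order_left: "\<lbrakk> oriented_simple_cograph G; edgeless I; pverts G \<inter> pverts I = {} \<rbrakk>
    \<Longrightarrow> oriented_simple_cograph (I \<oslash> G)"

lemma edgeless_iff: "edgeless G \<longleftrightarrow> finite (pverts G) \<and> pverts G \<noteq> {} \<and> parcs G = {}"
  unfolding edgeless_def is_digraph_def pair_digraph_def pair_fin_digraph_def
    pair_loopfree_digraph_def pair_wf_digraph_def pair_fin_digraph_axioms_def
    pair_loopfree_digraph_axioms_def
  by auto

lemma oriented_simple_cograph_rename:
  assumes "oriented_simple_cograph G" "inj_on f (pverts G)"
  shows "oriented_simple_cograph \<lparr> pverts = f ` pverts G, parcs = map_prod f f ` parcs G \<rparr>"
    (is "oriented_simple_cograph (?r G)")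
  using assms
proof (induction rule: oriented_simple_cograph.induct)
  case (single v)
  show ?case
    using oriented_simple_cograph.single[of "f v"] by (simp add: single_vertex_def)
next
  case (union G I)
  have inj: "inj_on f (pverts G \<union> pverts I)"
    using union.prems by (simp add: disj_union_def Un_commute)
  have "pverts (?r G) \<inter> pverts (?r I) = {}"
    using union.hyps(3) inj_on_image_Int[OF inj, of "pverts G" "pverts I"] by simp
  moreover have "edgeless (?r I)" "inj_on f (pverts G)" "?r (G \<oplus> I) = ?r G \<oplus> ?r I"
    using union.hyps(2) inj by (auto simp: edgeless_iff disj_union_def inj_on_Un)
  ultimately show ?case
    using union.IH oriented_simple_cograph.union by metis
next
  case (order_right G I)
  have inj: "inj_on f (pverts G \<union> pverts I)"
    using order_right.prems by (simp add: order_comp_def Un_commute)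
  have "pverts (?r G) \<inter> pverts (?r I) = {}"
    using order_right.hyps(3) inj_on_image_Int[OF inj, of "pverts G" "pverts I"] by simp
  moreover have "edgeless (?r I)" "inj_on f (pverts G)" "?r (G \<oslash> I) = ?r G \<oslash> ?r I"
    using order_right.hyps(2) inj by (auto simp: edgeless_iff order_comp_def inj_on_Un)
  ultimately show ?case
    using order_right.IH oriented_simple_cograph.order_right by metis
next
  case (order_left G I)
  have inj: "inj_on f (pverts G \<union> pverts I)"
    using order_left.prems by (simp add: order_comp_def Un_commute)
  have "pverts (?r G) \<inter> pverts (?r I) = {}"
    using order_left.hyps(3) inj_on_image_Int[OF inj, of "pverts G" "pverts I"] by simp
  moreover have "edgeless (?r I)" "inj_on f (pverts G)" "?r (I \<oslash> G) = ?r I \<oslash> ?r G"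
    using order_left.hyps(2) inj by (auto simp: edgeless_iff order_comp_def inj_on_Un)
  ultimately show ?case
    using order_left.IH oriented_simple_cograph.order_left by metis
qed

text \<open>
  The forbidden digraphs live on natural numbers, while members of \<open>Free F\<close> may have
  vertices of any type; \<^const>\<open>digraph_iso\<close> relates digraphs over different types.
\<close>

definition Free :: "nat pair_pre_digraph set \<Rightarrow> 'a pair_pre_digraph set" where
  "Free F = {G. is_digraph G \<and>
    \<not> (\<exists>H\<in>F. \<exists>G'. induced_subgraph (with_proj G') (with_proj G) \<and>
                   digraph_iso (with_proj G') (with_proj H))}"

definition K2_bidir :: "nat pair_pre_digraph" where
  "K2_bidir = \<lparr> pverts = {0, 1}, parcs = {(0, 1), (1, 0)} \<rparr>"

definition P2 :: "nat \<Rightarrow> nat \<Rightarrow> nat pair_pre_digraph" where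
  "P2 u v = \<lparr> pverts = {u, v}, parcs = {(u, v)} \<rparr>"

definition D1 :: "nat pair_pre_digraph" where
  "D1 = \<lparr> pverts = {0, 1, 2}, parcs = {(0, 1), (1, 2)} \<rparr>"

definition D5 :: "nat pair_pre_digraph" where
  "D5 = \<lparr> pverts = {0, 1, 2}, parcs = {(0, 1), (1, 2), (2, 0)} \<rparr>"

definition D8 :: "nat pair_pre_digraph" where
  "D8 = \<lparr> pverts = {0, 1, 2, 3}, parcs = {(0, 1), (2, 1), (2, 3)} \<rparr>"

definition co_D11 :: "nat pair_pre_digraph" where
  "co_D11 = P2 0 1 \<oplus> P2 2 3"

definition Y4 :: "nat \<Rightarrow> nat \<Rightarrow> nat \<Rightarrow> nat pair_pre_digraph" where
  "Y4 a b c = P2 a b \<oplus> single_vertex c"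

definition Q7 :: "nat pair_pre_digraph" where
  "Q7 = Y4 0 1 2 \<oslash> Y4 3 4 5"

end

theory Submission
  imports Defs
begin

text \<open>
  A forbidden digraph has no nonempty edgeless part that can be split off by one of the three
  operations, so an induced copy of it in an oriented simple co-graph survives the removal of the
  edgeless operand, all the way down to a single vertex.

  Conversely, let \<open>G\<close> be transitive and omit the bidirected edge, so that its arcs form a strict
  order \<open><\<close>. Omitting \<open>D\<^sub>8\<close> and \<open>co-D\<^sub>1\<^sub>1\<close> says that \<open>a < y\<close> and \<open>w < b\<close> imply \<open>a < b\<close>, unless
  \<open>w < a\<close> or \<open>b < y\<close>. If \<open>G\<close> has no isolated vertex, then either the minimal elements lie below all
  others, or the maximal elements lie above all others, and an edgeless part splits off.
  Otherwise there are \<open>a' < x\<close> with \<open>a\<close> minimal and \<open>a \<not>< x\<close>, and dually \<open>z < b'\<close> with \<open>b\<close> maximal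
  and \<open>z \<not>< b\<close>; the exchange property forces \<open>a < b\<close>, then \<open>x < b\<close> and \<open>a < z\<close>, then \<open>x < z\<close>, and
  these six vertices induce \<open>Q\<^sub>7\<close>.
\<close>

section \<open>Induced containment up to isomorphism as a vertex injection\<close>

definition embeds :: "'b pair_pre_digraph \<Rightarrow> 'a pair_pre_digraph \<Rightarrow> bool" where
  "embeds H G \<longleftrightarrow> (\<exists>f. inj_on f (pverts H) \<and> f ` pverts H \<subseteq> pverts G \<and>
    (\<forall>u\<in>pverts H. \<forall>v\<in>pverts H. (u, v) \<in> parcs H \<longleftrightarrow> (f u, f v) \<in> parcs G))"

lemma is_digraph_iff:
  "is_digraph G \<longleftrightarrow> finite (pverts G) \<and> pverts G \<noteq> {} \<and>
    parcs G \<subseteq> pverts G \<times> pverts G \<and> (\<forall>u. (u, u) \<notin> parcs G)"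
proof -
  have "finite (parcs G)" if "finite (pverts G)" "parcs G \<subseteq> pverts G \<times> pverts G"
    using that finite_subset by blast
  then show ?thesis
    unfolding is_digraph_def pair_digraph_def pair_fin_digraph_def pair_loopfree_digraph_def
      pair_wf_digraph_def pair_fin_digraph_axioms_def pair_loopfree_digraph_axioms_def
    by fastforce
qed

text \<open>\<open>with_proj\<close> forces \<open>iso_tail h\<close> and \<open>iso_head h\<close>
  to be the projections, so on arcs the isomorphism is determined by its vertex part; the inverse of
  that part is the embedding.\<close>

lemma embeds_if_induced_iso:
  assumes "induced_subgraph (with_proj G') (with_proj G)"
    and "digraph_iso (with_proj G') (with_proj H)"
  shows "embeds H G"
proof -
  obtain h where h: "pre_digraph.digraph_isomorphism (with_proj G') h"
    and H: "with_proj H = app_iso h (with_proj G')"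
    using assms(2) unfolding digraph_iso_def by blast
  let ?h = "iso_verts h"
  have V: "pverts H = ?h ` pverts G'" and E: "parcs H = iso_arcs h ` parcs G'"
    and "iso_tail h = fst" "iso_head h = snd"
    using H by (auto simp: with_proj_def app_iso_def)
  with h have inj: "inj_on ?h (pverts G')"
    and arc: "\<And>e. e \<in> parcs G' \<Longrightarrow> iso_arcs h e = map_prod ?h ?h e"
    unfolding pre_digraph.digraph_isomorphism_def
    by (auto simp: prod_eq_iff)
  have sub: "pverts G' \<subseteq> pverts G" and E': "parcs G' = parcs G \<inter> pverts G' \<times> pverts G'"
    using assms(1) by (auto simp: induced_subgraph_def subgraph_def)
  have EH: "parcs H = map_prod ?h ?h ` parcs G'"
    unfolding E using arc by (rule image_cong[OF refl])
  let ?f = "inv_into (pverts G') ?h"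
  have "inj_on ?f (pverts H)" unfolding V by (rule inj_on_inv_into) simp
  moreover have "?f ` pverts H \<subseteq> pverts G" using inj sub unfolding V by auto
  moreover have "(?h u, ?h v) \<in> parcs H \<longleftrightarrow> (u, v) \<in> parcs G"
    if "u \<in> pverts G'" "v \<in> pverts G'" for u v
    using that inj E' unfolding EH by (auto dest: inj_onD)
  ultimately show ?thesis
    unfolding embeds_def V using inj by (intro exI[of _ ?f]) auto
qed

text \<open>The copy is induced on the image of \<open>f\<close>, and the inverse of
  \<open>f\<close> is the isomorphism. The condition on \<open>H\<close> ensures that each of its
  arcs is reached from an arc between vertices of the image.\<close>

lemma induced_iso_if_embeds:
  assumes G: "parcs G \<subseteq> pverts G \<times> pverts G" and H: "parcs H \<subseteq> pverts H \<times> pverts H"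
    and "embeds H G"
  shows "\<exists>G'. induced_subgraph (with_proj G') (with_proj G) \<and>
    digraph_iso (with_proj G') (with_proj H)"
proof -
  obtain f where inj: "inj_on f (pverts H)" and sub: "f ` pverts H \<subseteq> pverts G"
    and arc: "\<And>u v. u \<in> pverts H \<Longrightarrow> v \<in> pverts H \<Longrightarrow> (u, v) \<in> parcs H \<longleftrightarrow> (f u, f v) \<in> parcs G"
    using assms(3) unfolding embeds_def by auto
  let ?S = "f ` pverts H"
  let ?G' = "\<lparr> pverts = ?S, parcs = parcs G \<inter> ?S \<times> ?S \<rparr>"
  let ?g = "inv_into (pverts H) f"
  let ?h = "\<lparr> iso_verts = ?g, iso_arcs = map_prod ?g ?g, iso_head = snd, iso_tail = fst \<rparr>"
  have wf: "wf_digraph (with_proj ?G')" "wf_digraph (with_proj G)"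
    using G by (auto simp: wf_digraph_def)
  have ind: "induced_subgraph (with_proj ?G') (with_proj G)"
    using sub wf by (auto simp: induced_subgraph_def subgraph_def compatible_def)
  have g: "inj_on ?g ?S" by (rule inj_on_inv_into) simp
  then have "inj_on (map_prod ?g ?g) (?S \<times> ?S)" by (rule map_prod_inj_on) (rule g)
  then have "pre_digraph.digraph_isomorphism (with_proj ?G') ?h"
    unfolding pre_digraph.digraph_isomorphism_def
    using wf g by (auto intro: inj_on_subset)
  moreover have "with_proj H = app_iso ?h (with_proj ?G')"
  proof -
    have "pverts H = ?g ` ?S" using inj by force
    moreover have "parcs H = map_prod ?g ?g ` (parcs G \<inter> ?S \<times> ?S)"
    proof (intro set_eqI iffI)
      fix e assume e: "e \<in> parcs H"
      then obtain u v where uv: "e = (u, v)" "u \<in> pverts H" "v \<in> pverts H" using H by auto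
      then have "(f u, f v) \<in> parcs G \<inter> ?S \<times> ?S" "e = map_prod ?g ?g (f u, f v)"
        using arc e inj by auto
      then show "e \<in> map_prod ?g ?g ` (parcs G \<inter> ?S \<times> ?S)" by blast
    qed (use arc inj in auto)
    ultimately show ?thesis by (simp add: with_proj_def app_iso_def)
  qed
  ultimately show ?thesis using ind unfolding digraph_iso_def by blast
qed

lemma Free_iff:
  assumes "\<And>H. H \<in> F \<Longrightarrow> parcs H \<subseteq> pverts H \<times> pverts H"
  shows "G \<in> Free F \<longleftrightarrow> is_digraph G \<and> (\<forall>H\<in>F. \<not> embeds H G)"
proof -
  have "(\<exists>G'. induced_subgraph (with_proj G') (with_proj G) \<and> digraph_iso (with_proj G') (with_proj H))
      \<longleftrightarrow> embeds H G" if "is_digraph G" "H \<in> F" for H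
    using that assms induced_iso_if_embeds[of G H] embeds_if_induced_iso[of _ G H]
    by (auto simp: is_digraph_iff)
  then show ?thesis unfolding Free_def by blast
qed

section \<open>Oriented simple co-graphs avoid the forbidden digraphs\<close>

lemmas forbidden_defs = D1_def D5_def D8_def Q7_def co_D11_def K2_bidir_def Y4_def P2_def
  single_vertex_def order_comp_def disj_union_def

text \<open>The three alternatives describe the trace left on \<open>H\<close> by an edgeless
  operand \<open>I\<close> of \<open>G \<oplus> I\<close>, \<open>G \<oslash> I\<close> and
  \<open>I \<oslash> G\<close>. The choice \<open>J = pverts H\<close> is allowed, which covers
  copies lying entirely inside \<open>I\<close>.\<close>

definition detachable :: "'b set \<Rightarrow> 'b pair_pre_digraph \<Rightarrow> bool" where
  "detachable J H \<longleftrightarrow> J \<noteq> {} \<and> J \<subseteq> pverts H \<and>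
    ((\<forall>u\<in>J. \<forall>v\<in>pverts H. (u, v) \<notin> parcs H \<and> (v, u) \<notin> parcs H) \<or>
     (\<forall>u\<in>J. \<forall>v\<in>pverts H. (u, v) \<notin> parcs H \<and> ((v, u) \<in> parcs H \<longleftrightarrow> v \<notin> J)) \<or>
     (\<forall>u\<in>J. \<forall>v\<in>pverts H. (v, u) \<notin> parcs H \<and> ((u, v) \<in> parcs H \<longleftrightarrow> v \<notin> J)))"

lemma oriented_simple_cograph_arcs:
  "oriented_simple_cograph G \<Longrightarrow> parcs G \<subseteq> pverts G \<times> pverts G"
  by (induction rule: oriented_simple_cograph.induct)
    (auto simp: single_vertex_def disj_union_def order_comp_def edgeless_iff)

text \<open>At each construction step the preimage of \<open>I\<close> is either empty, so that
  \<open>H\<close> already embeds in \<open>G\<close>, or itself detachable.\<close>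

lemma detachable_if_embeds:
  assumes "oriented_simple_cograph G" "embeds H G" "pverts H \<noteq> {}"
  shows "\<exists>J. detachable J H"
  using assms(1,2)
proof (induction rule: oriented_simple_cograph.induct)
  case (single v)
  then have "detachable (pverts H) H"
    using assms(3) by (auto simp: embeds_def detachable_def single_vertex_def)
  then show ?case ..
next
  case (union G I)
  from union.prems obtain f where f: "inj_on f (pverts H)" "f ` pverts H \<subseteq> pverts (G \<oplus> I)"
    "\<forall>u\<in>pverts H. \<forall>v\<in>pverts H. (u, v) \<in> parcs H \<longleftrightarrow> (f u, f v) \<in> parcs (G \<oplus> I)"
    unfolding embeds_def by blast
  let ?J = "{v \<in> pverts H. f v \<in> pverts I}"
  show ?case
  proof (cases "?J = {}")
    case True
    then have "embeds H G" unfolding embeds_def using f union.hyps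
      by (intro exI[of _ f]) (auto simp: disj_union_def edgeless_iff)
    then show ?thesis by (rule union.IH)
  next
    case False
    then have "detachable ?J H" unfolding detachable_def
      using f union.hyps oriented_simple_cograph_arcs[OF union.hyps(1)]
      by (auto simp: disj_union_def edgeless_iff)
    then show ?thesis ..
  qed
next
  case (order_right G I)
  from order_right.prems obtain f where f: "inj_on f (pverts H)" "f ` pverts H \<subseteq> pverts (G \<oslash> I)"
    "\<forall>u\<in>pverts H. \<forall>v\<in>pverts H. (u, v) \<in> parcs H \<longleftrightarrow> (f u, f v) \<in> parcs (G \<oslash> I)"
    unfolding embeds_def by blast
  let ?J = "{v \<in> pverts H. f v \<in> pverts I}"
  show ?case
  proof (cases "?J = {}")
    case True
    then have "embeds H G" unfolding embeds_def using f order_right.hyps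
      by (intro exI[of _ f]) (auto simp: order_comp_def edgeless_iff)
    then show ?thesis by (rule order_right.IH)
  next
    case False
    then have "detachable ?J H" unfolding detachable_def
      using f order_right.hyps oriented_simple_cograph_arcs[OF order_right.hyps(1)]
      by (intro conjI disjI2 disjI1) (auto simp: order_comp_def edgeless_iff)
    then show ?thesis ..
  qed
next
  case (order_left G I)
  from order_left.prems obtain f where f: "inj_on f (pverts H)" "f ` pverts H \<subseteq> pverts (I \<oslash> G)"
    "\<forall>u\<in>pverts H. \<forall>v\<in>pverts H. (u, v) \<in> parcs H \<longleftrightarrow> (f u, f v) \<in> parcs (I \<oslash> G)"
    unfolding embeds_def by blast
  let ?J = "{v \<in> pverts H. f v \<in> pverts I}"
  show ?case
  proof (cases "?J = {}")
    case True
    then have "embeds H G" unfolding embeds_def using f order_left.hyps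
      by (intro exI[of _ f]) (auto simp: order_comp_def edgeless_iff)
    then show ?thesis by (rule order_left.IH)
  next
    case False
    then have "detachable ?J H" unfolding detachable_def
      using f order_left.hyps oriented_simple_cograph_arcs[OF order_left.hyps(1)]
      by (intro conjI disjI2) (auto simp: order_comp_def edgeless_iff)
    then show ?thesis ..
  qed
qed

lemma not_detachable:
  assumes "H \<in> {D1, D5, D8, Q7, co_D11, K2_bidir}"
  shows "\<not> detachable J H"
proof
  let ?V = "pverts H" and ?E = "parcs H"
  assume "detachable J H"
  \<comment> \<open>Quantifying over the explicit finite set \<open>?V\<close> reduces the claim to
    propositional logic in the atoms \<open>i \<in> J\<close>.\<close>
  then have J: "\<exists>u\<in>?V. u \<in> J" and
    E: "(\<forall>u\<in>?V. \<forall>v\<in>?V. u \<in> J \<longrightarrow> (u, v) \<notin> ?E \<and> (v, u) \<notin> ?E) \<or>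
     (\<forall>u\<in>?V. \<forall>v\<in>?V. u \<in> J \<longrightarrow> (u, v) \<notin> ?E \<and> ((v, u) \<in> ?E \<longleftrightarrow> v \<notin> J)) \<or>
     (\<forall>u\<in>?V. \<forall>v\<in>?V. u \<in> J \<longrightarrow> (v, u) \<notin> ?E \<and> ((u, v) \<in> ?E \<longleftrightarrow> v \<notin> J))"
    unfolding detachable_def by blast+
  consider "H = D1" | "H = D5" | "H = D8" | "H = Q7" | "H = co_D11" | "H = K2_bidir"
    using assms by blast
  then show False
    by cases (use J E in \<open>elim disjE; simp add: forbidden_defs; argo\<close>)+
qed

section \<open>Transitivity and the forbidden digraphs on two and three vertices\<close>

lemma embeds_K2_bidirI: "embeds K2_bidir G"
  if "u \<in> pverts G" "v \<in> pverts G" "(u, v) \<in> parcs G" "(v, u) \<in> parcs G" "\<forall>w. (w, w) \<notin> parcs G"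
  unfolding embeds_def using that
  \<comment> \<open>The vertices of the forbidden digraphs are numbered from 0, so the list gives
    their images in order.\<close>
  by (intro exI[of _ "\<lambda>i. [u, v] ! i"]) (auto simp: forbidden_defs)

text \<open>A failure of transitivity at \<open>u\<close>, \<open>v\<close>, \<open>w\<close>
  induces \<open>D5\<close> or \<open>D1\<close>, according to whether the arc from \<open>w\<close>
  to \<open>u\<close> is present.\<close>

lemma transitive_if_free:
  assumes G: "is_digraph G"
    and free: "\<not> embeds D1 G" "\<not> embeds D5 G" "\<not> embeds K2_bidir G"
  shows "transitive_digraph G"
  unfolding transitive_digraph_def
proof (intro allI impI, rule ccontr)
  fix u v w assume a: "(u, v) \<in> parcs G \<and> (v, w) \<in> parcs G \<and> u \<noteq> w" and uw: "(u, w) \<notin> parcs G"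
  have loop: "\<forall>x. (x, x) \<notin> parcs G" and V: "u \<in> pverts G" "v \<in> pverts G" "w \<in> pverts G"
    using G a by (auto simp: is_digraph_iff)
  then have asym: "(v, u) \<notin> parcs G" "(w, v) \<notin> parcs G"
    using a free(3) embeds_K2_bidirI by metis+
  have ne: "u \<noteq> v" "v \<noteq> w" using a loop by auto
  have "embeds (if (w, u) \<in> parcs G then D5 else D1) G"
    unfolding embeds_def using a uw V asym loop ne
    by (intro exI[of _ "\<lambda>i. [u, v, w] ! i"]) (auto simp: forbidden_defs)
  then show False using free by (auto split: if_splits)
qed

text \<open>Both digraphs contain the path 0, 1, 2 without the arc from 0 to 2.\<close>

lemma not_embeds_if_transitive:
  assumes "transitive_digraph G" "H \<in> {D1, D5}"
  shows "\<not> embeds H G"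
proof
  assume "embeds H G"
  then obtain f where "inj_on f (pverts H)"
    and "\<forall>u\<in>pverts H. \<forall>v\<in>pverts H. (u, v) \<in> parcs H \<longleftrightarrow> (f u, f v) \<in> parcs G"
    unfolding embeds_def by blast
  then have "f 0 \<noteq> f 2" "(f 0, f 1) \<in> parcs G" "(f 1, f 2) \<in> parcs G" "(f 0, f 2) \<notin> parcs G"
    using assms(2) by (auto simp: D1_def D5_def)
  then show False using assms(1) unfolding transitive_digraph_def by blast
qed

section \<open>The strict order of a transitive digraph and its extremal elements\<close>

locale order_digraph =
  fixes G :: "'a pair_pre_digraph"
  assumes digraph: "is_digraph G"
    and transitive: "transitive_digraph G"
    and free: "\<not> embeds D8 G" "\<not> embeds Q7 G" "\<not> embeds co_D11 G" "\<not> embeds K2_bidir G"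
begin

abbreviation less (infix \<open>\<prec>\<close> 50) where "u \<prec> v \<equiv> (u, v) \<in> parcs G"

lemma arc_verts: "u \<prec> v \<Longrightarrow> u \<in> pverts G \<and> v \<in> pverts G"
  using digraph by (auto simp: is_digraph_iff)

lemma irrefl: "\<not> u \<prec> u"
  using digraph by (auto simp: is_digraph_iff)

lemma asym: "u \<prec> v \<Longrightarrow> \<not> v \<prec> u"
  using free(4) embeds_K2_bidirI arc_verts irrefl by metis

lemma less_trans: "u \<prec> v \<Longrightarrow> v \<prec> w \<Longrightarrow> u \<prec> w"
  using transitive asym unfolding transitive_digraph_def by metis

text \<open>If \<open>a \<prec> b\<close> failed, transitivity would leave
  \<open>w \<prec> y\<close> as the only possible further arc among the four vertices: with it they
  induce \<open>D8\<close>, without it \<open>co_D11\<close>.\<close>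

lemma exchange:
  assumes "a \<prec> y" "w \<prec> b" "\<not> w \<prec> a" "\<not> b \<prec> y"
  shows "a \<prec> b"
proof (rule ccontr)
  assume ab: "\<not> a \<prec> b"
  have non: "\<not> y \<prec> a" "\<not> b \<prec> w" "\<not> a \<prec> w" "\<not> y \<prec> b" "\<not> y \<prec> w" "\<not> b \<prec> a"
    using assms ab asym less_trans by metis+
  have dist: "a \<noteq> y" "a \<noteq> w" "a \<noteq> b" "y \<noteq> w" "y \<noteq> b" "w \<noteq> b"
    using assms ab irrefl less_trans by metis+
  have "embeds (if w \<prec> y then D8 else co_D11) G"
    unfolding embeds_def using assms ab non dist arc_verts irrefl
    by (intro exI[of _ "\<lambda>i. [a, y, w, b] ! i"]) (auto simp: forbidden_defs)
  then show False using free by (auto split: if_splits)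
qed

lemma acyclic: "acyclic (parcs G)"
proof -
  have "trans (parcs G)" using less_trans by (rule transI)
  then show ?thesis by (simp add: acyclic_def irrefl)
qed

lemma finite_arcs: "finite (parcs G)"
  using digraph by (auto simp: is_digraph_iff intro: finite_subset)

lemma ex_minimal: "\<exists>a\<in>pverts G. \<forall>u. \<not> u \<prec> a"
proof -
  have "wf (parcs G)" using finite_arcs acyclic by (rule finite_acyclic_wf)
  moreover have "pverts G \<noteq> {}" using digraph by (simp add: is_digraph_iff)
  ultimately show ?thesis using arc_verts unfolding wf_eq_minimal by (metis ex_in_conv)
qed

lemma ex_maximal: "\<exists>b\<in>pverts G. \<forall>u. \<not> b \<prec> u"
proof -
  have "wf ((parcs G)\<inverse>)" using finite_arcs acyclic by (rule finite_acyclic_wf_converse)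
  moreover have "pverts G \<noteq> {}" using digraph by (simp add: is_digraph_iff)
  ultimately show ?thesis using arc_verts unfolding wf_eq_minimal by (metis ex_in_conv converse_iff)
qed

lemma minimal_below_or_maximal_above:
  assumes no_isolated: "\<forall>v\<in>pverts G. \<exists>u. u \<prec> v \<or> v \<prec> u"
  shows "(\<forall>a\<in>pverts G. \<forall>x. (\<forall>u. \<not> u \<prec> a) \<longrightarrow> (\<exists>u. u \<prec> x) \<longrightarrow> a \<prec> x) \<or>
    (\<forall>b\<in>pverts G. \<forall>z. (\<forall>u. \<not> b \<prec> u) \<longrightarrow> (\<exists>u. z \<prec> u) \<longrightarrow> z \<prec> b)"
proof (rule ccontr)
  assume "\<not> ?thesis"
  then obtain a a' x b b' z where a: "a \<in> pverts G" "\<And>u. \<not> u \<prec> a" "a' \<prec> x" "\<not> a \<prec> x"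
    and b: "b \<in> pverts G" "\<And>u. \<not> b \<prec> u" "z \<prec> b'" "\<not> z \<prec> b"
    by blast
  \<comment> \<open>Neither \<open>a\<close> nor \<open>b\<close> is isolated, so the minimal
    \<open>a\<close> has a successor and the maximal \<open>b\<close> a predecessor.\<close>
  obtain y w where "a \<prec> y" "w \<prec> b" using no_isolated a b by meson
  then have ab: "a \<prec> b" using a b exchange by blast
  \<comment> \<open>By contradiction: without \<open>x \<prec> b\<close>, exchanging
    \<open>a \<prec> b\<close> with \<open>a' \<prec> x\<close> would give
    \<open>a \<prec> x\<close>. The next two steps likewise contradict
    \<open>\<not> z \<prec> b\<close> and \<open>\<not> a \<prec> x\<close>.\<close>
  have xb: "x \<prec> b" using exchange[of a' x a b] exchange[of a b a' x] a ab by blast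
  have az: "a \<prec> z" using exchange[of z b' a b] b ab by blast
  have xz: "x \<prec> z" using exchange[of a z a' x] a az by blast
  have below: "a' \<prec> z" "a' \<prec> b" "a' \<prec> b'" "x \<prec> b'" "a \<prec> b'"
    using a b xb az xz less_trans by blast+
  have non: "\<not> a \<prec> a'" "\<not> b' \<prec> b" using a b less_trans by blast+
  have dist: "a' \<noteq> a" "x \<noteq> a" "z \<noteq> b" "b' \<noteq> b" using a b by metis+
  have "u \<noteq> v" if "u \<prec> v" for u v using that irrefl by metis
  note ne = this
  \<comment> \<open>The arc from \<open>a'\<close> to \<open>x\<close> with the vertex
    \<open>a\<close> forms the lower \<open>Y4\<close>, and the arc from \<open>z\<close> to
    \<open>b'\<close> with \<open>b\<close> the upper one.\<close>
  have "embeds Q7 G"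
    unfolding embeds_def
    using a b ab xb az xz below non dist irrefl
      ne[OF a(3)] ne[OF b(3)] ne[OF ab] ne[OF xb] ne[OF az] ne[OF xz] below[THEN ne]
      asym[OF a(3)] asym[OF b(3)] asym[OF ab] asym[OF xb] asym[OF az] asym[OF xz] below[THEN asym]
      arc_verts[OF a(3)] arc_verts[OF b(3)]
    by (intro exI[of _ "\<lambda>i. [a', x, a, z, b', b] ! i"]) (simp add: forbidden_defs)
  then show False using free by blast
qed

end

section \<open>Decomposition by splitting off edgeless parts\<close>

definition restrict_verts :: "'a pair_pre_digraph \<Rightarrow> 'a set \<Rightarrow> 'a pair_pre_digraph" where
  "restrict_verts G S = \<lparr> pverts = S, parcs = parcs G \<inter> S \<times> S \<rparr>"

lemma embeds_restrict_verts:
  assumes "embeds H (restrict_verts G S)" "S \<subseteq> pverts G"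
  shows "embeds H G"
proof -
  from assms(1) obtain f where "inj_on f (pverts H)" "f ` pverts H \<subseteq> S"
    "\<forall>u\<in>pverts H. \<forall>v\<in>pverts H. (u, v) \<in> parcs H \<longleftrightarrow> (f u, f v) \<in> parcs G \<inter> S \<times> S"
    unfolding embeds_def restrict_verts_def by auto
  then show ?thesis using assms(2) unfolding embeds_def by (intro exI[of _ f]) auto
qed

lemma order_digraph_restrict_verts:
  assumes "order_digraph G" "S \<subseteq> pverts G" "S \<noteq> {}"
  shows "order_digraph (restrict_verts G S)"
proof (rule order_digraph.intro)
  have "finite S" using assms order_digraph.digraph finite_subset is_digraph_iff by metis
  then show "is_digraph (restrict_verts G S)"
    using order_digraph.irrefl[OF assms(1)] assms(3) by (auto simp: is_digraph_iff restrict_verts_def)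
  show "transitive_digraph (restrict_verts G S)"
    unfolding transitive_digraph_def restrict_verts_def
    by (auto intro: order_digraph.less_trans[OF assms(1)])
qed (use order_digraph.free[OF assms(1)] in \<open>auto dest: embeds_restrict_verts[OF _ assms(2)]\<close>)

text \<open>Strong induction on the number of vertices works because the assumptions of
  \<open>order_digraph\<close> pass to nonempty induced subdigraphs.\<close>

lemma oriented_simple_cograph_if_order_digraph:
  assumes "order_digraph G"
  shows "oriented_simple_cograph G"
  using assms
proof (induction "card (pverts G)" arbitrary: G rule: less_induct)
  case less
  interpret order_digraph G by fact
  have fin: "finite (pverts G)" using digraph by (simp add: is_digraph_iff)
  have E: "parcs G \<subseteq> pverts G \<times> pverts G" using arc_verts by auto
  let ?I = "\<lambda>S. \<lparr> pverts = S, parcs = {} \<rparr>"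
  let ?R = "\<lambda>S. restrict_verts G (pverts G - S)"
  have split: "oriented_simple_cograph (?R S)" "edgeless (?I S)" "pverts (?R S) \<inter> pverts (?I S) = {}"
    if "S \<subset> pverts G" "S \<noteq> {}" for S
  proof -
    have "card (pverts G - S) < card (pverts G)"
      using that fin by (intro psubset_card_mono) auto
    then show "oriented_simple_cograph (?R S)"
      using that less.hyps[of "?R S"] order_digraph_restrict_verts[OF less.prems, of "pverts G - S"]
      by (auto simp: restrict_verts_def)
    show "edgeless (?I S)" using that fin by (auto simp: edgeless_iff intro: finite_subset)
  qed (auto simp: restrict_verts_def)
  consider (isolated) v where "v \<in> pverts G" "\<forall>u. (u, v) \<notin> parcs G \<and> (v, u) \<notin> parcs G"
    | (minimal) "\<forall>v\<in>pverts G. \<exists>u. (u, v) \<in> parcs G \<or> (v, u) \<in> parcs G"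
        "\<forall>a\<in>pverts G. \<forall>x. (\<forall>u. (u, a) \<notin> parcs G) \<longrightarrow> (\<exists>u. (u, x) \<in> parcs G) \<longrightarrow> (a, x) \<in> parcs G"
    | (maximal) "\<forall>v\<in>pverts G. \<exists>u. (u, v) \<in> parcs G \<or> (v, u) \<in> parcs G"
        "\<forall>b\<in>pverts G. \<forall>z. (\<forall>u. (b, u) \<notin> parcs G) \<longrightarrow> (\<exists>u. (z, u) \<in> parcs G) \<longrightarrow> (z, b) \<in> parcs G"
  proof (cases "\<forall>v\<in>pverts G. \<exists>u. (u, v) \<in> parcs G \<or> (v, u) \<in> parcs G")
    case True
    from minimal_below_or_maximal_above[OF True] show thesis
      by (rule disjE) (rule that(2,3)[OF True], assumption)+
  next
    case False
    then show thesis using that(1) by auto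
  qed
  then show ?case
  proof cases
    case isolated
    show ?thesis
    \<comment> \<open>Removing \<open>v\<close> must leave a nonempty digraph, so a lone vertex is
      the base case.\<close>
    proof (cases "pverts G = {v}")
      case True
      then have "G = single_vertex v"
        using isolated E by (auto simp: single_vertex_def intro!: pair_pre_digraph.equality)
      then show ?thesis using oriented_simple_cograph.single by metis
    next
      case False
      then have "{v} \<subset> pverts G" using isolated by auto
      then have "oriented_simple_cograph (?R {v} \<oplus> ?I {v})"
        by (intro oriented_simple_cograph.union split) auto
      moreover have "?R {v} \<oplus> ?I {v} = G"
        using isolated E by (auto simp: disj_union_def restrict_verts_def intro!: pair_pre_digraph.equality)
      ultimately show ?thesis by simp
    qed
  next
    case minimal
    let ?A = "{a \<in> pverts G. \<forall>u. (u, a) \<notin> parcs G}"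
    obtain a where a: "a \<in> ?A" using ex_minimal by blast
    \<comment> \<open>The successor \<open>y\<close> is not minimal, so the part left after removing
      \<open>?A\<close> is nonempty.\<close>
    then obtain y where "(a, y) \<in> parcs G" using minimal(1) by auto
    then have "?A \<subset> pverts G" using arc_verts by blast
    then have "oriented_simple_cograph (?I ?A \<oslash> ?R ?A)"
      using a by (intro oriented_simple_cograph.order_left split) auto
    \<comment> \<open>Every vertex outside \<open>?A\<close> has a predecessor, hence lies above all
      of \<open>?A\<close>; no arc enters \<open>?A\<close>.\<close>
    moreover have "?I ?A \<oslash> ?R ?A = G"
      using minimal(2) E
      by (intro pair_pre_digraph.equality; simp add: order_comp_def restrict_verts_def; blast)
    ultimately show ?thesis by simp
  next
    case maximal
    let ?B = "{b \<in> pverts G. \<forall>u. (b, u) \<notin> parcs G}"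
    obtain b where b: "b \<in> ?B" using ex_maximal by blast
    then obtain w where "(w, b) \<in> parcs G" using maximal(1) by auto
    then have "?B \<subset> pverts G" using arc_verts by blast
    then have "oriented_simple_cograph (?R ?B \<oslash> ?I ?B)"
      using b by (intro oriented_simple_cograph.order_right split) auto
    moreover have "?R ?B \<oslash> ?I ?B = G"
      using maximal(2) E
      by (intro pair_pre_digraph.equality; simp add: order_comp_def restrict_verts_def; blast)
    ultimately show ?thesis by simp
  qed
qed

theorem theorem4p42:
  fixes G :: "'a pair_pre_digraph"
  assumes "is_digraph G"
  shows "(oriented_simple_cograph G \<longleftrightarrow> G \<in> Free {D1, D5, D8, Q7, co_D11, K2_bidir}) \<and>
    (G \<in> Free {D1, D5, D8, Q7, co_D11, K2_bidir} \<longleftrightarrow>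
      G \<in> Free {D8, Q7, co_D11, K2_bidir} \<and> transitive_digraph G)"
proof -
  let ?F = "{D1, D5, D8, Q7, co_D11, K2_bidir}"
  have wf: "parcs H \<subseteq> pverts H \<times> pverts H" "pverts H \<noteq> {}" if "H \<in> ?F" for H
    using that by (auto simp: forbidden_defs)
  have F: "G \<in> Free ?F \<longleftrightarrow> (\<forall>H\<in>?F. \<not> embeds H G)"
    using assms wf Free_iff[of ?F G] by blast
  have F': "G \<in> Free {D8, Q7, co_D11, K2_bidir} \<longleftrightarrow>
      (\<forall>H\<in>{D8, Q7, co_D11, K2_bidir}. \<not> embeds H G)"
    using assms wf Free_iff[of "{D8, Q7, co_D11, K2_bidir}" G] by blast
  have iff: "G \<in> Free ?F \<longleftrightarrow> G \<in> Free {D8, Q7, co_D11, K2_bidir} \<and> transitive_digraph G"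
    unfolding F F' using transitive_if_free not_embeds_if_transitive assms by blast
  moreover have "G \<in> Free ?F" if "oriented_simple_cograph G"
    unfolding F using that detachable_if_embeds wf(2) not_detachable by metis
  moreover have "oriented_simple_cograph G" if "G \<in> Free ?F"
  proof -
    have "order_digraph G" using that assms iff unfolding F F' by unfold_locales auto
    then show ?thesis by (rule oriented_simple_cograph_if_order_digraph)
  qed
  ultimately show ?thesis by blast
qed

end
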